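(* Let $\Gamma$ be a countably infinite group. Let $k,\ell \geq 1$ be integers and let $\pi \colon \mathrm{Free}(k^\Gamma) \to \ell^\Gamma$ be a continuous $\Gamma$-equivariant map. Then either $\pi$ is constant and $\mathrm{Stab}(\pi) = \Gamma$, or else, $\mathrm{Stab}(\pi)$ is a finite normal subgroup of $\Gamma$.
   Context: $\Gamma$ is a countably infinite group with identity $\mathbf{1}$. An integer $k$ is identified with the discrete set $\{0,1,\ldots,k-1\}$. $k^\Gamma$ is the set of functions $\Gamma \to k$ with the product topology, and the (Bernoulli) shift action $\Gamma \curvearrowright k^\Gamma$ is $(\gamma\cdot x)(\delta) = x(\delta\gamma)$ for $x \in k^\Gamma$, $\gamma,\delta\in\Gamma$. $\mathrm{Stab}(x)$ is the stabilizer of $x$, and $\mathrm{Free}(k^\Gamma) = \{x \in k^\Gamma : \mathrm{Stab}(x) = \{\mathbf{1}\}\}$ (with the subspace topology). For a $\Gamma$-equivariant map $\pi\colon X \to Y$ between sets with $\Gamma$-actions, $\mathrm{Stab}(\pi) = \bigcap\{\mathrm{Stab}(\pi(x)) : x\in X\}$, i.e., the set of all $\gamma \in \Gamma$ with $\gamma\cdot\pi(x) = \pi(x)$ for every $x\in X$ (an empty intersection is $\Gamma$). The map $\pi$ is constant if $\pi(x)=\pi(y)$ for all $x,y$ in its domain (so the empty map, which occurs for $k=1$, counts as constant). *)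

theory Defs
  imports "HOL-Algebra.Group_Action" "HOL-Analysis.Function_Topology"
begin

text \<open>
  Elements of \<open>k\<^sup>\<Gamma>\<close> are extensional functions: they take the value \<open>undefined\<close>
  outside the carrier of the group.
\<close>

definition cfg_space :: "('a, 'm) monoid_scheme \<Rightarrow> nat \<Rightarrow> ('a \<Rightarrow> nat) set" where
  "cfg_space G k = (\<Pi>\<^sub>E \<delta>\<in>carrier G. {..<k})"

definition cfg_topology :: "('a, 'm) monoid_scheme \<Rightarrow> nat \<Rightarrow> ('a \<Rightarrow> nat) topology" where
  "cfg_topology G k = product_topology (\<lambda>\<delta>. discrete_topology {..<k}) (carrier G)"

text \<open>
  The outer restriction makes each \<open>bernoulli_shift G k \<gamma>\<close> an element of
  \<open>BijGroup (cfg_space G k)\<close>, as the library's notion of a group action requires.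
\<close>

definition bernoulli_shift ::
    "('a, 'm) monoid_scheme \<Rightarrow> nat \<Rightarrow> 'a \<Rightarrow> ('a \<Rightarrow> nat) \<Rightarrow> ('a \<Rightarrow> nat)" where
  "bernoulli_shift G k \<gamma> =
     (\<lambda>x\<in>cfg_space G k. \<lambda>\<delta>\<in>carrier G. x (\<delta> \<otimes>\<^bsub>G\<^esub> \<gamma>))"

definition free_part :: "('a, 'm) monoid_scheme \<Rightarrow> nat \<Rightarrow> ('a \<Rightarrow> nat) set" where
  "free_part G k =
     {x \<in> cfg_space G k. stabilizer G (bernoulli_shift G k) x = {\<one>\<^bsub>G\<^esub>}}"

definition free_topology :: "('a, 'm) monoid_scheme \<Rightarrow> nat \<Rightarrow> ('a \<Rightarrow> nat) topology" where
  "free_topology G k = subtopology (cfg_topology G k) (free_part G k)"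

definition equivariant_on ::
    "('a, 'm) monoid_scheme \<Rightarrow> 'b set \<Rightarrow> ('a \<Rightarrow> 'b \<Rightarrow> 'b) \<Rightarrow> ('a \<Rightarrow> 'c \<Rightarrow> 'c) \<Rightarrow> ('b \<Rightarrow> 'c) \<Rightarrow> bool"
  where "equivariant_on G X \<phi> \<psi> f \<longleftrightarrow>
     (\<forall>\<gamma>\<in>carrier G. \<forall>x\<in>X. f (\<phi> \<gamma> x) = \<psi> \<gamma> (f x))"

text \<open>
  Here \<open>X\<close> is the domain of \<open>f\<close> and \<open>\<psi>\<close> the action on its codomain. Intersecting with the
  carrier only matters when \<open>X\<close> is empty: the empty intersection is the whole group.
\<close>

definition map_stabilizer ::
    "('a, 'm) monoid_scheme \<Rightarrow> 'b set \<Rightarrow> ('a \<Rightarrow> 'c \<Rightarrow> 'c) \<Rightarrow> ('b \<Rightarrow> 'c) \<Rightarrow> 'a set" where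
  "map_stabilizer G X \<psi> f = carrier G \<inter> (\<Inter>x\<in>X. stabilizer G \<psi> (f x))"

lemma topspace_cfg_topology: "topspace (cfg_topology G k) = cfg_space G k"
  by (simp add: cfg_topology_def cfg_space_def)

lemma topspace_free_topology: "topspace (free_topology G k) = free_part G k"
  by (auto simp: free_topology_def topspace_cfg_topology free_part_def)

lemma bernoulli_shift_in_cfg_space:
  assumes "group G" "\<gamma> \<in> carrier G" "x \<in> cfg_space G k"
  shows "bernoulli_shift G k \<gamma> x \<in> cfg_space G k"
proof -
  interpret group G by fact
  show ?thesis using assms by (auto simp: bernoulli_shift_def cfg_space_def PiE_iff)
qed

lemma bernoulli_shift_mult:
  assumes "group G" "\<gamma> \<in> carrier G" "\<delta> \<in> carrier G" "x \<in> cfg_space G k"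
  shows "bernoulli_shift G k (\<gamma> \<otimes>\<^bsub>G\<^esub> \<delta>) x
    = bernoulli_shift G k \<gamma> (bernoulli_shift G k \<delta> x)"
proof -
  interpret group G by fact
  show ?thesis
    using assms bernoulli_shift_in_cfg_space[of G \<delta> x k]
    by (auto simp: bernoulli_shift_def m_assoc fun_eq_iff)
qed

lemma bernoulli_shift_one:
  assumes "group G" "x \<in> cfg_space G k"
  shows "bernoulli_shift G k \<one>\<^bsub>G\<^esub> x = x"
proof -
  interpret group G by fact
  show ?thesis
    using assms by (auto simp: bernoulli_shift_def cfg_space_def PiE_iff extensional_def fun_eq_iff)
qed

lemma group_action_bernoulli_shift:
  assumes "group G"
  shows "group_action G (cfg_space G k) (bernoulli_shift G k)"
proof -
  interpret group G by fact
  have ext: "bernoulli_shift G k \<gamma> \<in> extensional (cfg_space G k)" for \<gamma>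
    by (simp add: bernoulli_shift_def)
  have inverse: "bernoulli_shift G k \<gamma> (bernoulli_shift G k (inv\<^bsub>G\<^esub> \<gamma>) x) = x"
    "bernoulli_shift G k (inv\<^bsub>G\<^esub> \<gamma>) (bernoulli_shift G k \<gamma> x) = x"
    if "\<gamma> \<in> carrier G" "x \<in> cfg_space G k" for \<gamma> x
    using that assms bernoulli_shift_mult[of G \<gamma> "inv\<^bsub>G\<^esub> \<gamma>" x k]
      bernoulli_shift_mult[of G "inv\<^bsub>G\<^esub> \<gamma>" \<gamma> x k]
    by (simp_all add: bernoulli_shift_one)
  have bij: "bernoulli_shift G k \<gamma> \<in> Bij (cfg_space G k)" if "\<gamma> \<in> carrier G" for \<gamma>
    unfolding Bij_def
    using that ext inverse bernoulli_shift_in_cfg_space[OF assms]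
    by (auto intro!: bij_betw_byWitness[where f' = "bernoulli_shift G k (inv\<^bsub>G\<^esub> \<gamma>)"])
  have mult: "bernoulli_shift G k (\<gamma> \<otimes>\<^bsub>G\<^esub> \<delta>)
      = compose (cfg_space G k) (bernoulli_shift G k \<gamma>) (bernoulli_shift G k \<delta>)"
    if "\<gamma> \<in> carrier G" "\<delta> \<in> carrier G" for \<gamma> \<delta>
    using that assms
    by (intro extensionalityI[OF ext compose_extensional])
       (simp add: bernoulli_shift_mult compose_eq)
  show ?thesis
    unfolding group_action_def group_hom_def group_hom_axioms_def
    using assms bij mult group_BijGroup[of "cfg_space G k"]
    by (auto simp: hom_def BijGroup_def)
qed

end

theory Submission
  imports Defs
begin

text \<open>
  Suppose that \<open>N = Stab(\<pi>)\<close> is infinite. Then \<open>f(x) = \<pi>(x)(\<one>)\<close> is a locally constant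
  \<open>N\<close>-invariant function on the free part. Given \<open>x\<close> and \<open>y\<close>, let \<open>D\<close> and \<open>E\<close> be finite windows
  which determine \<open>f\<close> near \<open>x\<close> and near \<open>y\<close>. Choose \<open>\<gamma> \<in> N\<close> with \<open>E\<gamma>\<close> disjoint from \<open>D\<close>. As the
  free part is dense, it has a point \<open>z\<close> that agrees with \<open>x\<close> on \<open>D\<close> and whose translate \<open>\<gamma>z\<close> agrees
  with \<open>y\<close> on \<open>E\<close>, whence \<open>f(x) = f(z) = f(\<gamma>z) = f(y)\<close>.
\<close>

lemma bernoulli_shift_apply:
  "\<lbrakk>x \<in> cfg_space G k; \<delta> \<in> carrier G\<rbrakk> \<Longrightarrow> bernoulli_shift G k \<gamma> x \<delta> = x (\<delta> \<otimes>\<^bsub>G\<^esub> \<gamma>)"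
  by (simp add: bernoulli_shift_def)

lemma map_stabilizer_iff:
  "\<gamma> \<in> map_stabilizer G X \<psi> f \<longleftrightarrow> \<gamma> \<in> carrier G \<and> (\<forall>x\<in>X. \<psi> \<gamma> (f x) = f x)"
  by (auto simp: map_stabilizer_def stabilizer_def)

lemma equivariant_onD:
  "\<lbrakk>equivariant_on G X \<phi> \<psi> f; \<gamma> \<in> carrier G; x \<in> X\<rbrakk> \<Longrightarrow> f (\<phi> \<gamma> x) = \<psi> \<gamma> (f x)"
  by (simp add: equivariant_on_def)

text \<open>The stabilizer of a translate is a conjugate of the stabilizer of the point, so it stays
  trivial.\<close>

lemma bernoulli_shift_in_free_part:
  fixes G (structure)
  assumes "group G" "\<gamma> \<in> carrier G" "x \<in> free_part G k"
  shows "bernoulli_shift G k \<gamma> x \<in> free_part G k"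
proof -
  interpret group G by fact
  have x: "x \<in> cfg_space G k"
    and stab: "\<And>\<delta>. \<lbrakk>\<delta> \<in> carrier G; bernoulli_shift G k \<delta> x = x\<rbrakk> \<Longrightarrow> \<delta> = \<one>"
    using assms(3) by (auto simp: free_part_def stabilizer_def)
  let ?y = "bernoulli_shift G k \<gamma> x"
  have y: "?y \<in> cfg_space G k"
    using assms(1,2) x by (rule bernoulli_shift_in_cfg_space)
  have "\<delta> = \<one>" if \<delta>: "\<delta> \<in> carrier G" "bernoulli_shift G k \<delta> ?y = ?y" for \<delta>
  proof -
    have "bernoulli_shift G k (inv \<gamma> \<otimes> (\<delta> \<otimes> \<gamma>)) x
        = bernoulli_shift G k (inv \<gamma>) (bernoulli_shift G k \<delta> ?y)"
      using assms \<delta>(1) x by (simp add: bernoulli_shift_mult)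
    also have "\<dots> = bernoulli_shift G k (inv \<gamma> \<otimes> \<gamma>) x"
      using assms \<delta> x bernoulli_shift_mult[of G "inv \<gamma>" \<gamma> x k] by simp
    also have "\<dots> = x"
      using assms x by (simp add: bernoulli_shift_one)
    finally have "inv \<gamma> \<otimes> (\<delta> \<otimes> \<gamma>) = \<one>"
      using assms(2) \<delta>(1) by (intro stab) auto
    then have "\<delta> \<otimes> \<gamma> = \<gamma>"
      using assms(2) \<delta>(1) inv_comm inv_equality by fastforce
    then show ?thesis
      using assms(2) \<delta>(1) by simp
  qed
  then show ?thesis
    using y assms(1) by (auto simp: free_part_def stabilizer_def bernoulli_shift_one)
qed

text \<open>By equivariance, \<open>inv \<gamma>\<close> maps the value at \<open>x\<close> to the
  value at a translate of \<open>x\<close>, which every \<delta> in the map stabilizer also fixes.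
  So conjugating \<delta> by \<gamma> again fixes \<open>f x\<close>.\<close>

lemma normal_map_stabilizer:
  fixes G (structure)
  assumes "group G"
    and act: "group_action G Y \<psi>"
    and f: "f ` X \<subseteq> Y"
    and X: "\<And>\<gamma> x. \<lbrakk>\<gamma> \<in> carrier G; x \<in> X\<rbrakk> \<Longrightarrow> \<phi> \<gamma> x \<in> X"
    and equiv: "equivariant_on G X \<phi> \<psi> f"
  shows "map_stabilizer G X \<psi> f \<lhd> G"
proof -
  interpret group G by fact
  interpret A: group_action G Y \<psi> by fact
  let ?N = "map_stabilizer G X \<psi> f"
  \<comment> \<open>Inserting the carrier keeps the family of subgroups nonempty when
    \<open>X\<close> is empty.\<close>
  have N: "?N = \<Inter>(insert (carrier G) ((\<lambda>x. stabilizer G \<psi> (f x)) ` X))"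
    by (auto simp: map_stabilizer_def)
  have "subgroup ?N G"
    unfolding N using f
    by (intro subgroups_Inter) (auto simp: subgroup_self intro!: A.stabilizer_subgroup)
  moreover have "\<gamma> \<otimes> \<delta> \<otimes> inv \<gamma> \<in> ?N" if \<gamma>: "\<gamma> \<in> carrier G" and \<delta>: "\<delta> \<in> ?N" for \<gamma> \<delta>
    unfolding map_stabilizer_iff
  proof (intro conjI ballI)
    have \<delta>c: "\<delta> \<in> carrier G" and fix_f: "\<And>x. x \<in> X \<Longrightarrow> \<psi> \<delta> (f x) = f x"
      using \<delta> by (auto simp: map_stabilizer_iff)
    show "\<gamma> \<otimes> \<delta> \<otimes> inv \<gamma> \<in> carrier G"
      using \<gamma> \<delta>c by simp
    fix x assume x: "x \<in> X"
    have fx: "f x \<in> Y" "\<psi> (inv \<gamma>) (f x) \<in> Y"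
      using f x A.element_image[OF inv_closed[OF \<gamma>], of "f x"] by auto
    have "\<psi> \<delta> (\<psi> (inv \<gamma>) (f x)) = \<psi> (inv \<gamma>) (f x)"
      using fix_f[OF X[of "inv \<gamma>" x]] equivariant_onD[OF equiv, of "inv \<gamma>" x] \<gamma> x by simp
    then have "\<psi> (\<gamma> \<otimes> \<delta> \<otimes> inv \<gamma>) (f x) = \<psi> \<gamma> (\<psi> (inv \<gamma>) (f x))"
      using A.composition_rule[OF fx(1), of "\<gamma> \<otimes> \<delta>" "inv \<gamma>"]
        A.composition_rule[OF fx(2) \<gamma> \<delta>c] \<gamma> \<delta>c by simp
    also have "\<dots> = f x"
      using A.composition_rule[OF fx(1) \<gamma>, of "inv \<gamma>"] A.id_eq_one fx(1) \<gamma>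
      by simp (metis restrict_apply')
    finally show "\<psi> (\<gamma> \<otimes> \<delta> \<otimes> inv \<gamma>) (f x) = f x" .
  qed
  ultimately show ?thesis
    by (simp add: normal_inv_iff)
qed

lemma constant_imp_map_stabilizer_eq_carrier:
  assumes X: "\<And>\<gamma> x. \<lbrakk>\<gamma> \<in> carrier G; x \<in> X\<rbrakk> \<Longrightarrow> \<phi> \<gamma> x \<in> X"
    and equiv: "equivariant_on G X \<phi> \<psi> f"
    and const: "\<forall>x\<in>X. \<forall>y\<in>X. f x = f y"
  shows "map_stabilizer G X \<psi> f = carrier G"
proof -
  have "\<psi> \<gamma> (f x) = f x" if "\<gamma> \<in> carrier G" "x \<in> X" for \<gamma> x
    using equivariant_onD[OF equiv that] const X[OF that] that(2) by metis
  then show ?thesis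
    by (auto simp: map_stabilizer_iff)
qed

text \<open>With one symbol the shift space is a single point, fixed by the whole group. This
  settles \<open>k = 1\<close>, where the pattern extension below lacks a second symbol.\<close>

lemma free_part_one_empty:
  assumes "group G" "infinite (carrier G)"
  shows "free_part G 1 = {}"
proof -
  interpret group G by fact
  obtain \<gamma> where \<gamma>: "\<gamma> \<in> carrier G" "\<gamma> \<noteq> \<one>\<^bsub>G\<^esub>"
    using assms(2) by (metis finite.emptyI finite_insert insertI1 rev_finite_subset subsetI)
  have "x = y" if "x \<in> cfg_space G 1" "y \<in> cfg_space G 1" for x y
    using that unfolding cfg_space_def
    by (rule PiE_ext) (use that in \<open>auto simp: cfg_space_def PiE_iff\<close>)
  then have "bernoulli_shift G 1 \<gamma> x = x" if "x \<in> cfg_space G 1" for x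
    using that bernoulli_shift_in_cfg_space[OF assms(1) \<gamma>(1)] by blast
  then show ?thesis
    using \<gamma> by (auto simp: free_part_def stabilizer_def)
qed

text \<open>Right multiplication by \<gamma> is injective, so each of the two conditions excludes
  only finitely many \<open>d\<close>. This supplies the recursive choice in the next lemma.\<close>

lemma infinite_group_avoiding:
  fixes G (structure)
  assumes "group G" "infinite N" "N \<subseteq> carrier G" "\<gamma> \<in> carrier G" "finite F" "finite F'"
  shows "\<exists>d\<in>N. d \<notin> F \<and> d \<otimes> \<gamma> \<notin> F'"
proof -
  interpret group G by fact
  have "infinite (N - (F \<union> (\<lambda>x. x \<otimes> inv \<gamma>) ` F'))"
    using assms by (intro Diff_infinite_finite) auto
  then obtain d where d: "d \<in> N" "d \<notin> F" "d \<notin> (\<lambda>x. x \<otimes> inv \<gamma>) ` F'"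
    by (metis DiffE UnI1 UnI2 finite.emptyI equals0I)
  have "d = (d \<otimes> \<gamma>) \<otimes> inv \<gamma>"
    using d(1) assms(3,4) by (simp add: m_assoc subset_iff)
  with d show ?thesis by blast
qed

text \<open>
  Enumerate the group as \<open>g\<^sub>0, g\<^sub>1, \<dots>\<close>. Points \<open>d\<^sub>n\<close> are chosen recursively off the window, with \<open>d\<^sub>n g\<^sub>n\<close>
  neither in the window nor equal to any \<open>d\<^sub>i\<close> unless \<open>g\<^sub>n = \<one>\<close>. The extension is \<open>1\<close> exactly at the
  \<open>d\<^sub>n\<close> outside the window, so \<open>d\<^sub>n\<close> witnesses that \<open>g\<^sub>n\<close> moves it.
\<close>

lemma free_part_extend_pattern:
  fixes G (structure)
  assumes "group G" "countable (carrier G)" "infinite (carrier G)" "k \<ge> 2"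
    and D: "finite D" "\<And>\<delta>. \<delta> \<in> D \<Longrightarrow> p \<delta> < k"
  shows "\<exists>z\<in>free_part G k. \<forall>\<delta>\<in>D \<inter> carrier G. z \<delta> = p \<delta>"
proof -
  interpret group G by fact
  define g where "g = from_nat_into (carrier G)"
  have range_g: "range g = carrier G"
    unfolding g_def using assms(2) one_closed by (intro range_from_nat_into) auto
  then have g: "g n \<in> carrier G" for n by blast
  \<comment> \<open>The two inequalities under \<open>i<n\<close> are complementary: the second
    keeps \<open>d n \<otimes> g n\<close> off earlier points, and the first, applied at a later
    index, keeps it off later points. Only the index \<open>n\<close> itself remains, and there
    \<open>g n \<noteq> \<one>\<close> is what separates the two.\<close>
  let ?P = "\<lambda>d n r. r \<in> carrier G \<and> r \<notin> D \<and> r \<otimes> g n \<notin> D \<and>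
    (\<forall>i<n. r \<noteq> d i \<otimes> g i \<and> r \<otimes> g n \<noteq> d i)"
  have "\<exists>d. \<forall>n. ?P d n (d n)"
  proof (rule dependent_wf_choice[OF wf_less_than])
    fix d :: "nat \<Rightarrow> 'a" and n :: nat
    show "\<exists>r. ?P d n r"
      using infinite_group_avoiding[OF assms(1,3) subset_refl g[of n],
          of "D \<union> (\<lambda>i. d i \<otimes> g i) ` {..<n}" "D \<union> d ` {..<n}"] D(1)
      by (auto simp: image_iff Ball_def)
  qed simp
  then obtain d where d: "\<And>n. ?P d n (d n)" by blast
  \<comment> \<open>The symbol 1 is legal because \<open>k \<ge> 2\<close>; on the window the
    prescribed pattern takes precedence.\<close>
  define z where "z = (\<lambda>\<delta>\<in>carrier G. if \<delta> \<in> D then p \<delta> else if \<delta> \<in> range d then 1 else 0)"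
  have z: "z \<in> cfg_space G k"
    using D(2) \<open>k \<ge> 2\<close> by (auto simp: z_def cfg_space_def)
  have "\<gamma> = \<one>" if \<gamma>: "\<gamma> \<in> carrier G" "bernoulli_shift G k \<gamma> z = z" for \<gamma>
  proof (rule ccontr)
    assume "\<gamma> \<noteq> \<one>"
    obtain n where n: "\<gamma> = g n"
      using \<gamma>(1) range_g by blast
    have "d n \<otimes> g n \<noteq> d i" for i
    proof (cases i n rule: linorder_cases)
      case equal
      have "d n \<otimes> g n \<noteq> d n"
        using \<open>\<gamma> \<noteq> \<one>\<close> n d[of n] g[of n] by simp
      with equal show ?thesis by simp
    qed (use d[of n] d[of i] in metis)+
    then have "z (d n \<otimes> g n) = 0"
      using d[of n] g[of n] by (auto simp: z_def)
    moreover have "z (d n) = 1"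
      using d[of n] by (simp add: z_def)
    moreover have "z (d n \<otimes> g n) = z (d n)"
      using bernoulli_shift_apply[OF z, of "d n" "g n"] \<gamma>(2) n d[of n] by simp
    ultimately show False by simp
  qed
  then have "z \<in> free_part G k"
    using z assms(1) by (auto simp: free_part_def stabilizer_def bernoulli_shift_one)
  then show ?thesis
    by (intro bexI[of _ z]) (simp_all add: z_def)
qed

text \<open>The coordinate at \<open>a\<close> is a continuous map to a discrete space, so its level
  sets are open. A basic open set of the product restricts only finitely many coordinates, and these
  form the window \<open>D\<close>.\<close>

lemma continuous_map_locally_constant:
  assumes cont: "continuous_map (free_topology G k) (cfg_topology G l) \<pi>"
    and x: "x \<in> free_part G k" and a: "a \<in> carrier G"
  obtains D where "finite D" "D \<subseteq> carrier G"
    "\<And>z. \<lbrakk>z \<in> free_part G k; \<And>\<delta>. \<delta> \<in> D \<Longrightarrow> z \<delta> = x \<delta>\<rbrakk> \<Longrightarrow> \<pi> z a = \<pi> x a"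
proof -
  have cont_a: "continuous_map (free_topology G k) (discrete_topology {..<l}) (\<lambda>x. \<pi> x a)"
    using continuous_map_compose[OF cont[unfolded cfg_topology_def]
        continuous_map_product_projection[OF a]] by (simp add: comp_def)
  have "\<pi> x a < l"
    using continuous_map_image_subset_topspace[OF cont_a] x by (auto simp: topspace_free_topology)
  then have "openin (free_topology G k) {w \<in> free_part G k. \<pi> w a \<in> {\<pi> x a}}"
    using openin_continuous_map_preimage[OF cont_a, of "{\<pi> x a}"]
    by (simp add: topspace_free_topology)
  then obtain T where T: "openin (cfg_topology G k) T"
      "{w \<in> free_part G k. \<pi> w a \<in> {\<pi> x a}} = T \<inter> free_part G k"
    unfolding free_topology_def openin_subtopology by blast
  have "x \<in> T" using T(2) x by blast
  then obtain U where U: "finite {i \<in> carrier G. U i \<noteq> {..<k}}"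
      "x \<in> Pi\<^sub>E (carrier G) U" "Pi\<^sub>E (carrier G) U \<subseteq> T"
    using T(1) unfolding cfg_topology_def openin_product_topology_alt by fastforce
  let ?D = "{i \<in> carrier G. U i \<noteq> {..<k}}"
  show thesis
  proof
    fix z assume z: "z \<in> free_part G k" "\<And>\<delta>. \<delta> \<in> ?D \<Longrightarrow> z \<delta> = x \<delta>"
    \<comment> \<open>Off \<open>?D\<close> the factor \<open>U\<close> is the full alphabet, so
      there it suffices that \<open>z\<close> is a configuration.\<close>
    have "z \<in> cfg_space G k"
      using z(1) by (simp add: free_part_def)
    then have "z \<in> Pi\<^sub>E (carrier G) U"
      using z(2) U(2) unfolding cfg_space_def PiE_iff by (metis (mono_tags, lifting) mem_Collect_eq)
    then show "\<pi> z a = \<pi> x a"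
      using U(3) T(2) z(1) by blast
  qed (use U(1) in auto)
qed

lemma infinite_map_stabilizer_imp_constant:
  fixes G (structure)
  assumes "group G" "countable (carrier G)" "infinite (carrier G)" "k \<ge> 2"
    and cont: "continuous_map (free_topology G k) (cfg_topology G l) \<pi>"
    and equiv: "equivariant_on G (free_part G k) (bernoulli_shift G k) (bernoulli_shift G l) \<pi>"
    and inf: "infinite (map_stabilizer G (free_part G k) (bernoulli_shift G l) \<pi>)"
    and x: "x \<in> free_part G k" and y: "y \<in> free_part G k"
  shows "\<pi> x = \<pi> y"
proof -
  interpret group G by fact
  let ?N = "map_stabilizer G (free_part G k) (bernoulli_shift G l) \<pi>"
  have \<pi>_cfg: "\<pi> w \<in> cfg_space G l" if "w \<in> free_part G k" for w
    using continuous_map_image_subset_topspace[OF cont] that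
    by (auto simp: topspace_free_topology topspace_cfg_topology)
  \<comment> \<open>Shifting by \<gamma> brings coordinate \<gamma> to the identity, so the identity
    coordinate on the free part determines all of \<pi>.\<close>
  have \<pi>_shift: "\<pi> (bernoulli_shift G k \<gamma> w) \<one> = \<pi> w \<gamma>"
    if "w \<in> free_part G k" "\<gamma> \<in> carrier G" for w \<gamma>
    using equivariant_onD[OF equiv that(2,1)] bernoulli_shift_apply[OF \<pi>_cfg[OF that(1)], of \<one> \<gamma>]
      that(2) by simp
  have one: "\<pi> x \<one> = \<pi> y \<one>" if x: "x \<in> free_part G k" and y: "y \<in> free_part G k" for x y
  proof -
    obtain D where D: "finite D" "D \<subseteq> carrier G"
        "\<And>z. \<lbrakk>z \<in> free_part G k; \<And>\<delta>. \<delta> \<in> D \<Longrightarrow> z \<delta> = x \<delta>\<rbrakk> \<Longrightarrow> \<pi> z \<one> = \<pi> x \<one>"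
      using continuous_map_locally_constant[OF cont x one_closed] by blast
    obtain E where E: "finite E" "E \<subseteq> carrier G"
        "\<And>z. \<lbrakk>z \<in> free_part G k; \<And>\<delta>. \<delta> \<in> E \<Longrightarrow> z \<delta> = y \<delta>\<rbrakk> \<Longrightarrow> \<pi> z \<one> = \<pi> y \<one>"
      using continuous_map_locally_constant[OF cont y one_closed] by blast
    \<comment> \<open>These quotients are exactly the \<gamma> for which the translate of
      \<open>E\<close> by \<gamma> meets \<open>D\<close>; an infinite stabilizer cannot lie inside
      this finite set.\<close>
    have "finite ((\<lambda>(\<epsilon>, \<delta>). inv \<epsilon> \<otimes> \<delta>) ` (E \<times> D))"
      using D(1) E(1) by simp
    then obtain \<gamma> where \<gamma>N: "\<gamma> \<in> ?N" and avoid: "\<gamma> \<notin> (\<lambda>(\<epsilon>, \<delta>). inv \<epsilon> \<otimes> \<delta>) ` (E \<times> D)"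
      using inf by (meson finite_subset subsetI)
    then have \<gamma>: "\<gamma> \<in> carrier G" by (simp add: map_stabilizer_iff)
    have disj: "\<epsilon> \<otimes> \<gamma> \<notin> D" if "\<epsilon> \<in> E" for \<epsilon>
    proof
      assume "\<epsilon> \<otimes> \<gamma> \<in> D"
      moreover have "\<gamma> = inv \<epsilon> \<otimes> (\<epsilon> \<otimes> \<gamma>)"
        using that E(2) \<gamma> by (simp add: m_assoc[symmetric] subset_iff)
      ultimately show False
        using avoid that by force
    qed
    \<comment> \<open>The second branch undoes the translation, so that shifting by \<gamma>
      restores \<open>y\<close> on \<open>E\<close>. Testing \<open>D\<close> first does no harm,
      because \<open>disj\<close> keeps the two windows apart.\<close>
    define p where "p = (\<lambda>\<delta>. if \<delta> \<in> D then x \<delta> else y (\<delta> \<otimes> inv \<gamma>))"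
    let ?E\<gamma> = "(\<lambda>\<epsilon>. \<epsilon> \<otimes> \<gamma>) ` E"
    have xy: "x \<delta> < k" "y \<delta> < k" if "\<delta> \<in> carrier G" for \<delta>
      using x y that by (auto simp: free_part_def cfg_space_def)
    have "p \<delta> < k" if "\<delta> \<in> D \<union> ?E\<gamma>" for \<delta>
      using that D(2) E(2) \<gamma> by (auto simp: p_def intro!: xy)
    then obtain z where z: "z \<in> free_part G k" "\<And>\<delta>. \<delta> \<in> (D \<union> ?E\<gamma>) \<inter> carrier G \<Longrightarrow> z \<delta> = p \<delta>"
      using free_part_extend_pattern[OF assms(1-4), of "D \<union> ?E\<gamma>" p] D(1) E(1) by blast
    have "bernoulli_shift G k \<gamma> z \<epsilon> = y \<epsilon>" if "\<epsilon> \<in> E" for \<epsilon>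
    proof -
      have \<epsilon>: "\<epsilon> \<in> carrier G"
        using that E(2) by blast
      then have "bernoulli_shift G k \<gamma> z \<epsilon> = p (\<epsilon> \<otimes> \<gamma>)"
        using z that \<gamma> by (simp add: bernoulli_shift_apply free_part_def)
      also have "\<dots> = y \<epsilon>"
        using disj[OF that] \<epsilon> \<gamma> by (simp add: p_def m_assoc)
      finally show ?thesis .
    qed
    then have "\<pi> (bernoulli_shift G k \<gamma> z) \<one> = \<pi> y \<one>"
      by (intro E(3) bernoulli_shift_in_free_part assms(1) \<gamma> z(1))
    moreover have "\<pi> z \<one> = \<pi> x \<one>"
      using z(2) D(2) by (intro D(3) z(1)) (auto simp: p_def)
    moreover have "\<pi> (bernoulli_shift G k \<gamma> z) = \<pi> z"
      using equivariant_onD[OF equiv \<gamma> z(1)] \<gamma>N z(1) by (simp add: map_stabilizer_iff)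
    ultimately show ?thesis by simp
  qed
  \<comment> \<open>Equality at the identity, applied to the translates of \<open>x\<close> and
    \<open>y\<close> by \<gamma>, gives equality at every coordinate.\<close>
  have "\<pi> x \<gamma> = \<pi> y \<gamma>" if "\<gamma> \<in> carrier G" for \<gamma>
    using one[OF bernoulli_shift_in_free_part[OF assms(1) that x]
        bernoulli_shift_in_free_part[OF assms(1) that y]] \<pi>_shift[OF x that] \<pi>_shift[OF y that]
    by simp
  then show ?thesis
    using \<pi>_cfg[OF x] \<pi>_cfg[OF y] unfolding cfg_space_def by (intro PiE_ext)
qed

theorem proposition1p3:
  fixes G :: "('a, 'm) monoid_scheme"
    and k l :: nat
    and \<pi> :: "('a \<Rightarrow> nat) \<Rightarrow> ('a \<Rightarrow> nat)"
  assumes "group G"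
    and "countable (carrier G)"
    and "infinite (carrier G)"
    and "k \<ge> 1"
    and "l \<ge> 1"
    and "continuous_map (free_topology G k) (cfg_topology G l) \<pi>"
    and "equivariant_on G (free_part G k) (bernoulli_shift G k) (bernoulli_shift G l) \<pi>"
  shows "((\<forall>x\<in>free_part G k. \<forall>y\<in>free_part G k. \<pi> x = \<pi> y)
            \<and> map_stabilizer G (free_part G k) (bernoulli_shift G l) \<pi> = carrier G)
       \<or> (finite (map_stabilizer G (free_part G k) (bernoulli_shift G l) \<pi>)
            \<and> map_stabilizer G (free_part G k) (bernoulli_shift G l) \<pi> \<lhd> G)"
proof -
  let ?N = "map_stabilizer G (free_part G k) (bernoulli_shift G l) \<pi>"
  note closed = bernoulli_shift_in_free_part[OF assms(1)]
  have "?N \<lhd> G"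
    using continuous_map_image_subset_topspace[OF assms(6)]
    by (intro normal_map_stabilizer[where Y = "cfg_space G l" and \<phi> = "bernoulli_shift G k"]
        assms(1,7) group_action_bernoulli_shift closed)
      (auto simp: topspace_free_topology topspace_cfg_topology)
  \<comment> \<open>Normality already gives the second alternative for finite \<open>?N\<close>. For
    infinite \<open>?N\<close> constancy suffices, since it forces the stabilizer to be the whole
    group.\<close>
  moreover have "\<forall>x\<in>free_part G k. \<forall>y\<in>free_part G k. \<pi> x = \<pi> y" if "infinite ?N"
  proof (cases "k = 1")
    case True
    then show ?thesis
      using free_part_one_empty[OF assms(1,3)] by simp
  next
    case False
    with \<open>k \<ge> 1\<close> have "k \<ge> 2" by simp
    then show ?thesis
      using infinite_map_stabilizer_imp_constant[OF assms(1-3) _ assms(6,7) that] by blast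
  qed
  ultimately show ?thesis
    using constant_imp_map_stabilizer_eq_carrier[of G "free_part G k" "bernoulli_shift G k"]
      closed assms(7) by blast
qed

end
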